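(* Let $Q\in\mathbb{H}[s,t]$ be primitive and $p\in\mathbb{C}$. (a) $[Q(s,p)]\subseteq\mathcal{L}_\alpha$ and $[Q(s,\overline{p})]\subseteq\mathcal{L}_{\overline{\alpha}}$ for some $[\alpha^*]\in\mathcal{N}$ if and only if $Q=\tilde{Q}\cdot(t-h)$ for some $\tilde{Q}\in\mathbb{H}[s,t]$ and $h\in\mathbb{H}$ such that $(p-h)\cdot(p-h)^*=0$. (b) $[Q(s,p)]\subseteq\mathcal{R}_\alpha$ and $[Q(s,\overline{p})]\subseteq\mathcal{R}_{\overline{\alpha}}$ for some $[\alpha^*]\in\mathcal{N}$ if and only if $Q=(t-h)\cdot\tilde{Q}$ for some $\tilde{Q}\in\mathbb{H}[s,t]$ and $h\in\mathbb{H}$ such that $(p-h)\cdot(p-h)^*=0$.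
   Context: $\mathbb{H}=\langle 1,\mathbf{i},\mathbf{j},\mathbf{k}\rangle_{\mathbb{R}}$ denotes the quaternions and $\mathbb{H}_{\mathbb{C}}=\mathbb{H}\otimes_{\mathbb{R}}\mathbb{C}\cong\mathbb{C}^4$ the complex quaternions (the imaginary unit of $\mathbb{C}$ is central and different from $\mathbf{i}$). For $h=h_1+h_2\mathbf{i}+h_3\mathbf{j}+h_4\mathbf{k}\in\mathbb{H}_{\mathbb{C}}$ the conjugate is $h^*=h_1-h_2\mathbf{i}-h_3\mathbf{j}-h_4\mathbf{k}$ and the complex conjugate is $\overline{h}=\overline{h_1}+\overline{h_2}\mathbf{i}+\overline{h_3}\mathbf{j}+\overline{h_4}\mathbf{k}$. In $\mathbb{H}_{\mathbb{C}}[s,t]\supset\mathbb{H}[s,t]$ the variables commute with each other and with the coefficients. $Q$ is primitive if it is not of the form $P\cdot\tilde{Q}$ with $P\in\mathbb{C}[s,t]$ non-constant and $\tilde Q\in\mathbb{H}_{\mathbb{C}}[s,t]$. For a subset $S\subset\mathbb{C}^4\cong\mathbb{H}_{\mathbb{C}}$, $\mathbb{P}(S)$ is the Zariski closure in complex projective space $\mathbb{P}^3$ of its projectivization (of the non-zero elements of $S$). For a non-zero polynomial $Q$ with coefficients in $\mathbb{H}_{\mathbb{C}}$, $[Q]:=\mathbb{P}(\{\text{values of }Q\text{ at complex arguments}\})$; so $[Q(s,p)]=\mathbb{P}(\{Q(s,p)\mid s\in\mathbb{C}\})$, and for a constant $q\in\mathbb{H}_{\mathbb{C}}\setminus\{0\}$,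 $[q]$ is the corresponding point of $\mathbb{P}^3$. The null quadric is $\mathcal{N}:=\mathbb{P}(\{h\in\mathbb{H}_{\mathbb{C}}\mid h\cdot h^*=0\})$. For $\alpha\in\mathbb{H}_{\mathbb{C}}\setminus\{0\}$ with $\alpha\cdot\alpha^*=0$ (equivalently $[\alpha^*]\in\mathcal{N}$), $\mathcal{L}_\alpha:=\mathbb{P}(\{h\in\mathbb{H}_{\mathbb{C}}\mid h\cdot\alpha=0\})$ and $\mathcal{R}_\alpha:=\mathbb{P}(\{h\in\mathbb{H}_{\mathbb{C}}\mid\alpha\cdot h=0\})$. *)

theory Defs
  imports Complex_Main "HOL.Hull" "HOL-Library.Poly_Mapping" "HOL-Library.Product_Plus"
begin

section \<open>Complex quaternions\<close>

text \<open>
  The algebra of complex quaternions, in coordinates with respect to the basis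
  \<open>1, i, j, k\<close>.  The imaginary unit \<open>\<i>\<close> of the coefficients is central and differs from the
  quaternion unit \<open>i\<close>.
\<close>

codatatype cquat =
  CQuat (coord1: complex) (coordi: complex) (coordj: complex) (coordk: complex)

lemma cquat_eqI:
  "coord1 x = coord1 y \<Longrightarrow> coordi x = coordi y \<Longrightarrow> coordj x = coordj y \<Longrightarrow> coordk x = coordk y
    \<Longrightarrow> x = y"
  by (rule cquat.expand) simp

lemma cquat_eq_iff:
  "x = y \<longleftrightarrow> coord1 x = coord1 y \<and> coordi x = coordi y \<and> coordj x = coordj y \<and> coordk x = coordk y"
  by (auto intro: cquat.expand)

instantiation cquat :: ring_1
begin

primcorec zero_cquat where
  "coord1 0 = 0"
| "coordi 0 = 0"
| "coordj 0 = 0"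
| "coordk 0 = 0"

primcorec one_cquat where
  "coord1 1 = 1"
| "coordi 1 = 0"
| "coordj 1 = 0"
| "coordk 1 = 0"

primcorec plus_cquat where
  "coord1 (x + y) = coord1 x + coord1 y"
| "coordi (x + y) = coordi x + coordi y"
| "coordj (x + y) = coordj x + coordj y"
| "coordk (x + y) = coordk x + coordk y"

primcorec uminus_cquat where
  "coord1 (- x) = - coord1 x"
| "coordi (- x) = - coordi x"
| "coordj (- x) = - coordj x"
| "coordk (- x) = - coordk x"

primcorec minus_cquat where
  "coord1 (x - y) = coord1 x - coord1 y"
| "coordi (x - y) = coordi x - coordi y"
| "coordj (x - y) = coordj x - coordj y"
| "coordk (x - y) = coordk x - coordk y"

primcorec times_cquat where
  "coord1 (x * y) =
     coord1 x * coord1 y - coordi x * coordi y - coordj x * coordj y - coordk x * coordk y"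
| "coordi (x * y) =
     coord1 x * coordi y + coordi x * coord1 y + coordj x * coordk y - coordk x * coordj y"
| "coordj (x * y) =
     coord1 x * coordj y - coordi x * coordk y + coordj x * coord1 y + coordk x * coordi y"
| "coordk (x * y) =
     coord1 x * coordk y + coordi x * coordj y - coordj x * coordi y + coordk x * coord1 y"

instance
  by standard (simp_all add: cquat_eq_iff algebra_simps)

end

text \<open>The multiplication table of the quaternion units.\<close>

lemma
  fixes i j k :: cquat
  defines "i \<equiv> CQuat 0 1 0 0" and "j \<equiv> CQuat 0 0 1 0" and "k \<equiv> CQuat 0 0 0 1"
  shows "i * i = - 1" "j * j = - 1" "k * k = - 1"
    "i * j = k" "j * k = i" "k * i = j" "j * i = - k" "k * j = - i" "i * k = - j"
  by (simp_all add: cquat_eq_iff assms)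

definition of_complex :: "complex \<Rightarrow> cquat" where
  "of_complex c = CQuat c 0 0 0"

primcorec qconj :: "cquat \<Rightarrow> cquat" where
  "coord1 (qconj h) = coord1 h"
| "coordi (qconj h) = - coordi h"
| "coordj (qconj h) = - coordj h"
| "coordk (qconj h) = - coordk h"

primcorec cconj :: "cquat \<Rightarrow> cquat" where
  "coord1 (cconj h) = cnj (coord1 h)"
| "coordi (cconj h) = cnj (coordi h)"
| "coordj (cconj h) = cnj (coordj h)"
| "coordk (cconj h) = cnj (coordk h)"

text \<open>The real quaternions and the complex numbers as subalgebras of \<^typ>\<open>cquat\<close>.\<close>

definition real_quats :: "cquat set" where
  "real_quats = {h. coord1 h \<in> \<real> \<and> coordi h \<in> \<real> \<and> coordj h \<in> \<real> \<and> coordk h \<in> \<real>}"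

definition complex_quats :: "cquat set" where
  "complex_quats = range of_complex"


section \<open>Polynomials in two commuting, central variables\<close>

text \<open>
  Coefficient of \<open>s^i t^j\<close> at key \<open>(i, j)\<close>.  The product of \<^type>\<open>poly_mapping\<close> is convolution:
  exponents are added and coefficients multiplied in their given order, so that \<open>s\<close> and \<open>t\<close>
  commute with each other and with all coefficients.
\<close>

type_synonym qpoly = "(nat \<times> nat) \<Rightarrow>\<^sub>0 cquat"

definition polys_over :: "cquat set \<Rightarrow> qpoly set" where
  "polys_over A = {Q. \<forall>m. Poly_Mapping.lookup Q m \<in> A}"

definition const_poly :: "cquat \<Rightarrow> qpoly" where
  "const_poly h = Poly_Mapping.single (0, 0) h"

definition var_t :: qpoly where
  "var_t = Poly_Mapping.single (0, 1) 1"

definition eval_qpoly :: "qpoly \<Rightarrow> complex \<Rightarrow> complex \<Rightarrow> cquat" where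
  "eval_qpoly Q s t = (\<Sum>(i, j)\<in>Poly_Mapping.keys Q. Poly_Mapping.lookup Q (i, j) * of_complex (s ^ i * t ^ j))"

definition primitive :: "qpoly \<Rightarrow> bool" where
  "primitive Q \<longleftrightarrow>
     \<not> (\<exists>P \<in> polys_over complex_quats. \<exists>Q'. P \<notin> range const_poly \<and> Q = P * Q')"


section \<open>Projective three-space over the complex numbers\<close>

text \<open>
  Points are the one-dimensional complex subspaces of \<^typ>\<open>cquat\<close>, so \<open>proj_point h\<close> is a
  point only for \<open>h \<noteq> 0\<close>.
\<close>

definition proj_point :: "cquat \<Rightarrow> cquat set" where
  "proj_point h = {of_complex c * h | c. True}"

text \<open>Polynomials in the four coordinates, indexed by exponent tuples.\<close>

type_synonym coord_poly = "(nat \<times> nat \<times> nat \<times> nat) \<Rightarrow>\<^sub>0 complex"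

definition eval_coord_poly :: "coord_poly \<Rightarrow> cquat \<Rightarrow> complex" where
  "eval_coord_poly f h =
     (\<Sum>(a, b, c, d)\<in>Poly_Mapping.keys f.
        Poly_Mapping.lookup f (a, b, c, d) * coord1 h ^ a * coordi h ^ b * coordj h ^ c * coordk h ^ d)"

definition homogeneous :: "coord_poly \<Rightarrow> bool" where
  "homogeneous f \<longleftrightarrow> (\<exists>n. \<forall>(a, b, c, d)\<in>Poly_Mapping.keys f. a + b + c + d = n)"

definition zariski_closed :: "cquat set set \<Rightarrow> bool" where
  "zariski_closed Z \<longleftrightarrow>
     (\<exists>F. (\<forall>f\<in>F. homogeneous f) \<and>
       Z = {proj_point h | h. h \<noteq> 0 \<and> (\<forall>f\<in>F. eval_coord_poly f h = 0)})"

text \<open>Zariski closure of the projectivization of a set.\<close>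

definition proj_closure :: "cquat set \<Rightarrow> cquat set set" where
  "proj_closure S = zariski_closed hull {proj_point h | h. h \<in> S \<and> h \<noteq> 0}"

definition null_quadric :: "cquat set set" where
  "null_quadric = proj_closure {h. h * qconj h = 0}"

definition left_space :: "cquat \<Rightarrow> cquat set set" where
  "left_space \<alpha> = proj_closure {h. h * \<alpha> = 0}"

definition right_space :: "cquat \<Rightarrow> cquat set set" where
  "right_space \<alpha> = proj_closure {h. \<alpha> * h = 0}"

text \<open>The variety \<open>[Q(s, p)]\<close> of the polynomial in \<open>s\<close> obtained by fixing \<open>t = p\<close>.\<close>

definition slice_variety :: "qpoly \<Rightarrow> complex \<Rightarrow> cquat set set" where
  "slice_variety Q p = proj_closure {eval_qpoly Q s p | s. True}"

end

theory Submission
  imports Defs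
begin

text \<open>
  Since \<open>\<L>\<^sub>\<alpha>\<close> is a linear subspace, the inclusion \<open>[Q(s, p)] \<subseteq> \<L>\<^sub>\<alpha>\<close> just says that
  \<open>Q(s, p) \<alpha> = 0\<close> for all \<open>s\<close>.  For a null quaternion \<open>\<alpha> \<noteq> 0\<close> there is a real quaternion \<open>h\<close>
  with \<open>(p - h) \<alpha> = 0\<close>.  Division with remainder gives \<open>Q = Q' (t - h) + R(s)\<close> over the real
  quaternions; hence \<open>R(s) \<alpha> = 0\<close>, and since \<open>\<alpha>\<close> is not annihilated by a non-zero real quaternion,
  \<open>R = 0\<close>.  Conversely, \<open>Q = Q' (t - h)\<close> is annihilated at \<open>t = p\<close> by the conjugate of \<open>p - h\<close>, which
  is non-zero because \<open>Q\<close> is primitive.  Part (b) is part (a) for the conjugate polynomial.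
\<close>

section \<open>Complex quaternions\<close>

lemma coord_of_complex [simp]:
  "coord1 (of_complex c) = c" "coordi (of_complex c) = 0"
  "coordj (of_complex c) = 0" "coordk (of_complex c) = 0"
  by (simp_all add: of_complex_def)

lemma of_complex_simps [simp]:
  "of_complex 0 = 0" "of_complex 1 = 1"
  by (simp_all add: cquat_eq_iff)

lemma of_complex_commute: "of_complex c * x = x * of_complex c"
  by (simp add: cquat_eq_iff algebra_simps)

lemma of_complex_left_commute: "x * (of_complex c * y) = of_complex c * (x * y)"
  by (metis mult.assoc of_complex_commute)

lemma mult_of_complex_mult: "(x * of_complex c) * (y * of_complex d) = x * y * of_complex (c * d)"
  by (simp add: cquat_eq_iff algebra_simps)

lemma of_complex_mult_eq_0_iff: "of_complex c * x = 0 \<longleftrightarrow> c = 0 \<or> x = 0"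
  by (auto simp: cquat_eq_iff)

lemma qconj_simps [simp]:
  "qconj 0 = 0" "qconj 1 = 1" "qconj (x + y) = qconj x + qconj y"
  "qconj (x - y) = qconj x - qconj y" "qconj (x * y) = qconj y * qconj x"
  "qconj (qconj x) = x" "qconj (of_complex c) = of_complex c"
  by (simp_all add: cquat_eq_iff algebra_simps)

lemma qconj_eq_0_iff [simp]: "qconj x = 0 \<longleftrightarrow> x = 0"
  by (metis qconj_simps(1,6))

lemma cconj_simps [simp]:
  "cconj 0 = 0" "cconj (x - y) = cconj x - cconj y" "cconj (x * y) = cconj x * cconj y"
  "cconj (qconj x) = qconj (cconj x)" "cconj (of_complex c) = of_complex (cnj c)"
  by (simp_all add: cquat_eq_iff)

text \<open>The complex-bilinear extension of the norm form, not a Hermitian norm: it is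
  complex-valued and vanishes on some non-zero quaternions.\<close>

definition qnorm :: "cquat \<Rightarrow> complex" where
  "qnorm x = (coord1 x)\<^sup>2 + (coordi x)\<^sup>2 + (coordj x)\<^sup>2 + (coordk x)\<^sup>2"

lemma mult_qconj: "x * qconj x = of_complex (qnorm x)"
  and qconj_mult: "qconj x * x = of_complex (qnorm x)"
  by (simp_all add: cquat_eq_iff qnorm_def power2_eq_square algebra_simps)

lemma mult_qconj_eq_0_iff: "x * qconj x = 0 \<longleftrightarrow> qnorm x = 0"
  by (simp add: mult_qconj cquat_eq_iff)

lemma mult_qconj_eq_0_commute: "qconj x * x = 0 \<longleftrightarrow> x * qconj x = 0"
  by (simp add: mult_qconj qconj_mult)

text \<open>Multiplying \<open>x * y = 0\<close> on the left by \<open>qconj x\<close> leaves the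
  scalar \<open>qnorm x\<close> acting on \<open>y\<close>.\<close>

lemma null_if_annihilates:
  assumes "x * y = 0" "y \<noteq> 0"
  shows "x * qconj x = 0"
proof -
  have "of_complex (qnorm x) * y = 0"
    using assms(1) by (simp add: qconj_mult [symmetric] mult.assoc)
  then show ?thesis
    using assms(2) by (simp add: of_complex_mult_eq_0_iff mult_qconj)
qed

section \<open>Real quaternions\<close>

lemma cconj_real_quat: "x \<in> real_quats \<Longrightarrow> cconj x = x"
  by (simp add: real_quats_def cquat_eq_iff Reals_cnj_iff)

lemma real_quats_closed:
  "0 \<in> real_quats"
  "x \<in> real_quats \<Longrightarrow> y \<in> real_quats \<Longrightarrow> x + y \<in> real_quats"
  "x \<in> real_quats \<Longrightarrow> y \<in> real_quats \<Longrightarrow> x * y \<in> real_quats"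
  "x \<in> real_quats \<Longrightarrow> qconj x \<in> real_quats"
  by (auto simp: real_quats_def)

text \<open>A left annihilator of \<open>y\<close> is null, and on real quaternions the norm is a
  sum of four real squares.\<close>

lemma real_quat_annihilator:
  assumes "x \<in> real_quats" "x * y = 0" "y \<noteq> 0"
  shows "x = 0"
proof -
  have "qnorm x = 0"
    using null_if_annihilates [OF assms(2,3)] by (simp add: mult_qconj cquat_eq_iff)
  moreover obtain a b c d where
    "coord1 x = complex_of_real a" "coordi x = complex_of_real b"
    "coordj x = complex_of_real c" "coordk x = complex_of_real d"
    using assms(1) by (auto simp: real_quats_def elim!: Reals_cases)
  moreover from calculation have "complex_of_real (a\<^sup>2 + b\<^sup>2 + c\<^sup>2 + d\<^sup>2) = 0"
    by (simp add: qnorm_def)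
  then have "a\<^sup>2 + b\<^sup>2 + c\<^sup>2 + d\<^sup>2 = 0"
    by (simp only: of_real_eq_0_iff)
  then have "a = 0 \<and> b = 0 \<and> c = 0 \<and> d = 0"
    by (simp add: add_nonneg_eq_0_iff)
  ultimately show ?thesis
    by (simp add: cquat_eq_iff)
qed

text \<open>
  Writing \<open>\<alpha> = \<beta> + \<i> \<gamma>\<close> with real \<open>\<beta>\<close>, \<open>\<gamma>\<close>, nullity of \<open>\<alpha>\<close> makes \<open>u = \<gamma> \<beta>\<^sup>-\<^sup>1\<close> a square root
  of \<open>-1\<close> with \<open>u \<alpha> = - \<i> \<alpha>\<close>, so that \<open>h = Re p - Im p u\<close> works.  The witness below is this \<open>h\<close>,
  expressed through \<open>\<alpha>\<close>.
\<close>

lemma real_quat_root: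
  assumes "\<alpha> \<noteq> 0" "\<alpha> * qconj \<alpha> = 0"
  obtains h where "h \<in> real_quats" "(of_complex p - h) * \<alpha> = 0"
proof -
  \<comment> \<open>The squared Hermitian norm of \<alpha>, which is non-zero although
    \<open>qnorm \<alpha>\<close> vanishes.\<close>
  define m where "m = (cmod (coord1 \<alpha>))\<^sup>2 + (cmod (coordi \<alpha>))\<^sup>2 + (cmod (coordj \<alpha>))\<^sup>2 + (cmod (coordk \<alpha>))\<^sup>2"
  have "m \<noteq> 0"
    using assms(1) by (simp add: m_def cquat_eq_iff add_nonneg_eq_0_iff)
  define v where "v = \<alpha> * qconj (cconj \<alpha>)"
  define h where "h = of_complex (cnj p) + of_complex (\<i> * Im p / m) * v"
  have m: "of_real m = coord1 \<alpha> * cnj (coord1 \<alpha>) + coordi \<alpha> * cnj (coordi \<alpha>)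
      + coordj \<alpha> * cnj (coordj \<alpha>) + coordk \<alpha> * cnj (coordk \<alpha>)"
    by (simp add: m_def complex_norm_square [symmetric])
  have v1: "coord1 v = of_real m"
    by (simp add: m v_def)
  have v2: "Re (coordi v) = 0" "Re (coordj v) = 0" "Re (coordk v) = 0"
    by (simp_all add: v_def)
  \<comment> \<open>The scalar part of \<open>h\<close> is
    \<open>cnj p + \<i> * Im p = Re p\<close>; in the other coordinates the factor \<i> meets the
    purely imaginary ones of \<open>v\<close>.\<close>
  have "h \<in> real_quats"
    using \<open>m \<noteq> 0\<close> by (simp add: real_quats_def h_def v1 v2 complex_is_Real_iff)
  moreover have "v * \<alpha> = of_complex (2 * m) * \<alpha>"
  proof -
    \<comment> \<open>The polarized norm form at \<alpha> and \<open>cconj \<alpha>\<close> is a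
      scalar. Its second summand disappears after left multiplication by \<alpha>, because
      \<open>\<alpha> * qconj \<alpha> = 0\<close>.\<close>
    have "qconj (cconj \<alpha>) * \<alpha> + qconj \<alpha> * cconj \<alpha> = of_complex (2 * m)"
      by (simp add: cquat_eq_iff m algebra_simps)
    then have "\<alpha> * (qconj (cconj \<alpha>) * \<alpha> + qconj \<alpha> * cconj \<alpha>) = of_complex (2 * m) * \<alpha>"
      by (simp add: of_complex_commute)
    then show ?thesis
      using assms(2) by (simp add: v_def distrib_left mult.assoc [symmetric])
  qed
  then have "(of_complex p - h) * \<alpha>
      = (of_complex p - of_complex (cnj p) - of_complex (\<i> * Im p / m) * of_complex (2 * m)) * \<alpha>"
    by (simp add: h_def left_diff_distrib distrib_right mult.assoc)
  moreover have "of_complex p - of_complex (cnj p) - of_complex (\<i> * Im p / m) * of_complex (2 * m) = 0"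
    using \<open>m \<noteq> 0\<close> by (simp add: cquat_eq_iff complex_eq_iff)
  ultimately show thesis
    by (intro that [of h]) simp_all
qed

section \<open>Polynomials\<close>

lemma poly_mapping_sum_single:
  fixes Q :: "'a \<Rightarrow>\<^sub>0 'b :: comm_monoid_add"
  shows "Q = (\<Sum>k\<in>Poly_Mapping.keys Q. Poly_Mapping.single k (Poly_Mapping.lookup Q k))"
  by (rule poly_mapping_eqI) (auto simp: lookup_sum lookup_single when_def in_keys_iff)

text \<open>The case \<open>single\<close> ranges over the terms of \<open>Q\<close> itself, so that
  assumptions on the coefficients of \<open>Q\<close> stay usable in the induction.\<close>

lemma poly_mapping_single_induct [case_names zero single add]:
  fixes Q :: "'a \<Rightarrow>\<^sub>0 'b :: comm_monoid_add"
  assumes "P 0"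
    and "\<And>k. P (Poly_Mapping.single k (Poly_Mapping.lookup Q k))"
    and add: "\<And>f g. P f \<Longrightarrow> P g \<Longrightarrow> P (f + g)"
  shows "P Q"
proof -
  have "finite A \<Longrightarrow> P (\<Sum>k\<in>A. Poly_Mapping.single k (Poly_Mapping.lookup Q k))" for A
    by (induction A rule: finite_induct) (auto intro: assms)
  then show ?thesis
    by (subst poly_mapping_sum_single) simp
qed

lemma polys_over_real_quats_closed:
  "0 \<in> polys_over real_quats"
  "P \<in> polys_over real_quats \<Longrightarrow> Q \<in> polys_over real_quats \<Longrightarrow> P + Q \<in> polys_over real_quats"
  "x \<in> real_quats \<Longrightarrow> Poly_Mapping.single k x \<in> polys_over real_quats"
  by (auto simp: polys_over_def lookup_add lookup_single when_def real_quats_closed)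

text \<open>By biadditivity it suffices to compare monomials, whose exponents add commutatively and
  whose complex coefficients are central.\<close>

lemma complex_poly_commute:
  assumes "P \<in> polys_over complex_quats"
  shows "P * Q = Q * P"
proof (induction P rule: poly_mapping_single_induct)
  case (single k)
  obtain c where c: "Poly_Mapping.lookup P k = of_complex c"
    using assms unfolding polys_over_def complex_quats_def by blast
  show ?case
    by (induction Q rule: poly_mapping_single_induct)
      (simp_all add: c mult_single add.commute of_complex_commute distrib_left distrib_right)
qed (simp_all add: distrib_left distrib_right)

subsection \<open>Evaluation\<close>

lemma eval_qpoly_superset:
  assumes "finite K" "Poly_Mapping.keys Q \<subseteq> K"
  shows "eval_qpoly Q s t
    = (\<Sum>(i, j)\<in>K. Poly_Mapping.lookup Q (i, j) * of_complex (s ^ i * t ^ j))"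
  unfolding eval_qpoly_def
  by (rule sum.mono_neutral_left) (use assms in \<open>auto simp: in_keys_iff\<close>)

lemma eval_qpoly_0 [simp]: "eval_qpoly 0 s t = 0"
  by (simp add: eval_qpoly_def)

lemma eval_qpoly_single [simp]:
  "eval_qpoly (Poly_Mapping.single (i, j) x) s t = x * of_complex (s ^ i * t ^ j)"
  by (cases "x = 0") (simp_all add: eval_qpoly_def)

lemma eval_qpoly_add [simp]:
  "eval_qpoly (P + Q) s t = eval_qpoly P s t + eval_qpoly Q s t"
proof -
  let ?K = "Poly_Mapping.keys P \<union> Poly_Mapping.keys Q"
  have "Poly_Mapping.keys (P + Q) \<subseteq> ?K"
    by (rule keys_add)
  then show ?thesis
    by (simp add: eval_qpoly_superset [where K = ?K] lookup_add distrib_right sum.distrib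
        case_prod_unfold)
qed

lemma eval_qpoly_diff [simp]:
  "eval_qpoly (P - Q) s t = eval_qpoly P s t - eval_qpoly Q s t"
  using eval_qpoly_add [of "P - Q" Q s t] by (simp add: eq_diff_eq)

text \<open>Multiplicativity rests on the arguments being complex, hence central.\<close>

lemma eval_qpoly_mult [simp]:
  "eval_qpoly (P * Q) s t = eval_qpoly P s t * eval_qpoly Q s t"
proof (induction P rule: poly_mapping_single_induct)
  case (single k)
  obtain i j where k: "k = (i, j)"
    by (cases k)
  show ?case
  proof (induction Q rule: poly_mapping_single_induct)
    case (single l)
    obtain i' j' where "l = (i', j')"
      by (cases l)
    then show ?case
      by (simp add: k mult_single power_add mult_of_complex_mult) (simp add: ac_simps)
  qed (simp_all add: distrib_left)
qed (simp_all add: distrib_right)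

lemma eval_qpoly_var_t [simp]: "eval_qpoly var_t s t = of_complex t"
  and eval_qpoly_const [simp]: "eval_qpoly (const_poly h) s t = h"
  by (simp_all add: var_t_def const_poly_def)

text \<open>\<open>R\<close> involves only \<open>s\<close>, so the product with \<alpha> is a
  polynomial in \<open>s\<close> that vanishes identically. Each coefficient of \<open>R\<close>
  thus annihilates \<alpha>, and being real it is zero.\<close>

lemma t_free_annihilated_eq_0:
  assumes "R \<in> polys_over real_quats" "Poly_Mapping.keys R \<subseteq> UNIV \<times> {0}"
    and "\<alpha> \<noteq> 0" "\<And>s. eval_qpoly R s t * \<alpha> = 0"
  shows "R = 0"
proof -
  obtain n where n: "fst ` Poly_Mapping.keys R \<subseteq> {..n}"
    using finite_nat_set_iff_bounded_le by (meson atMost_iff finite_imageI finite_keys subsetI)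
  define a where "a i = Poly_Mapping.lookup R (i, 0) * \<alpha>" for i
  have "eval_qpoly R s t * \<alpha> = (\<Sum>i\<le>n. a i * of_complex (s ^ i))" for s
  proof -
    have "Poly_Mapping.keys R \<subseteq> {..n} \<times> {0}"
      using assms(2) n by fastforce
    then have "eval_qpoly R s t
        = (\<Sum>(i, j)\<in>{..n} \<times> {0}. Poly_Mapping.lookup R (i, j) * of_complex (s ^ i * t ^ j))"
      by (intro eval_qpoly_superset) simp_all
    also have "\<dots> = (\<Sum>i\<le>n. Poly_Mapping.lookup R (i, 0) * of_complex (s ^ i))"
      by (simp add: sum.cartesian_product [symmetric])
    finally show ?thesis
      by (simp add: a_def sum_distrib_right mult.assoc of_complex_commute)
  qed
  then have *: "(\<Sum>i\<le>n. a i * of_complex (s ^ i)) = 0" for s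
    using assms(4) by simp
  \<comment> \<open>The identity theorem for polynomials is applied over the complex numbers;
    \<open>f\<close> stands for any of the four coordinate functionals.\<close>
  have "f (a i) = 0"
    if "i \<le> n" "f 0 = 0" "\<And>x y. f (x + y) = f x + f y" "\<And>x c. f (x * of_complex c) = f x * c"
    for i and f :: "cquat \<Rightarrow> complex"
  proof -
    have "f (\<Sum>i\<in>A. g i) = (\<Sum>i\<in>A. f (g i))" for A and g :: "nat \<Rightarrow> cquat"
      by (induction A rule: infinite_finite_induct) (simp_all add: that)
    then have "(\<Sum>i\<le>n. f (a i) * s ^ i) = 0" for s
      using arg_cong [where f = f, OF * [of s]] that by simp
    then show ?thesis
      using polyfun_eq_0 [of "\<lambda>i. f (a i)" n] that(1) by blast
  qed
  note ** = this
  have "a i = 0" if "i \<le> n" for i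
    using that by (intro cquat_eqI) (simp_all add: **)
  then have "Poly_Mapping.lookup R (i, 0) = 0" if "i \<le> n" for i
    using that assms(1,3) real_quat_annihilator unfolding a_def polys_over_def by blast
  moreover have "snd k = 0 \<and> fst k \<le> n" if "k \<in> Poly_Mapping.keys R" for k
    using that assms(2) n by auto
  ultimately have "Poly_Mapping.keys R = {}"
    by (metis equals0I in_keys_iff prod.collapse)
  then show ?thesis
    by simp
qed

subsection \<open>Division with remainder\<close>

text \<open>Replacing one factor \<open>t\<close> by \<open>(t - h) + h\<close> lowers the degree in
  \<open>t\<close> and turns the coefficient \<open>x\<close> into \<open>x * h\<close>; hence the
  induction generalizes over \<open>x\<close>.\<close>

lemma linear_division_single:
  assumes "h \<in> real_quats" "x \<in> real_quats"
  shows "\<exists>Q'\<in>polys_over real_quats. \<exists>R\<in>polys_over real_quats.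
    Poly_Mapping.keys R \<subseteq> UNIV \<times> {0} \<and>
    Poly_Mapping.single (i, j) x = Q' * (var_t - const_poly h) + R"
  using assms(2)
proof (induction j arbitrary: x)
  case 0
  then show ?case
    by (intro bexI [of _ 0] bexI [of _ "Poly_Mapping.single (i, 0) x"])
      (simp_all add: polys_over_real_quats_closed)
next
  case (Suc j)
  then have "x * h \<in> real_quats"
    using assms(1) by (simp add: real_quats_closed)
  from Suc.IH [OF this] obtain Q' R where
    *: "Q' \<in> polys_over real_quats" "R \<in> polys_over real_quats" "Poly_Mapping.keys R \<subseteq> UNIV \<times> {0}"
      "Poly_Mapping.single (i, j) (x * h) = Q' * (var_t - const_poly h) + R"
    by blast
  have "Poly_Mapping.single (i, Suc j) x
      = Poly_Mapping.single (i, j) x * (var_t - const_poly h) + Poly_Mapping.single (i, j) (x * h)"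
    by (simp add: var_t_def const_poly_def right_diff_distrib mult_single)
  also have "\<dots> = (Poly_Mapping.single (i, j) x + Q') * (var_t - const_poly h) + R"
    by (simp add: *(4) distrib_right add.assoc)
  finally show ?case
    using * Suc.prems polys_over_real_quats_closed by blast
qed

lemma linear_division:
  assumes "h \<in> real_quats" "Q \<in> polys_over real_quats"
  shows "\<exists>Q'\<in>polys_over real_quats. \<exists>R\<in>polys_over real_quats.
    Poly_Mapping.keys R \<subseteq> UNIV \<times> {0} \<and> Q = Q' * (var_t - const_poly h) + R"
proof (induction Q rule: poly_mapping_single_induct)
  case zero
  show ?case
    by (intro bexI [of _ 0]) (simp_all add: polys_over_real_quats_closed)
next
  case (single k)
  show ?case
    using assms linear_division_single by (cases k) (auto simp: polys_over_def)
next
  case (add f g)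
  then obtain F R G S where
    "F \<in> polys_over real_quats" "R \<in> polys_over real_quats" "Poly_Mapping.keys R \<subseteq> UNIV \<times> {0}"
    "f = F * (var_t - const_poly h) + R"
    "G \<in> polys_over real_quats" "S \<in> polys_over real_quats" "Poly_Mapping.keys S \<subseteq> UNIV \<times> {0}"
    "g = G * (var_t - const_poly h) + S"
    by blast
  then show ?case
    using keys_add [of R S]
    by (intro bexI [of _ "F + G"] bexI [of _ "R + S"])
      (auto simp: polys_over_real_quats_closed distrib_right)
qed

text \<open>For complex \<open>h\<close> the factor \<open>t - h\<close> would be central and
  non-constant, and moving it to the front would contradict primitivity.\<close>

lemma primitive_linear_factor:
  assumes "primitive (Q * (var_t - const_poly h))"
  shows "h \<noteq> of_complex p"
proof
  assume h: "h = of_complex p"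
  have "Poly_Mapping.lookup (var_t - const_poly h) k
      = of_complex ((1 when k = (0, 1)) - (p when k = (0, 0)))" for k
    by (auto simp: var_t_def const_poly_def lookup_minus lookup_single when_def h cquat_eq_iff)
  then have "var_t - const_poly h \<in> polys_over complex_quats"
    unfolding polys_over_def complex_quats_def by blast
  moreover have "var_t - const_poly h \<noteq> const_poly x" for x
  proof
    assume "var_t - const_poly h = const_poly x"
    then have "Poly_Mapping.lookup (var_t - const_poly h) (0, 1) = Poly_Mapping.lookup (const_poly x) (0, 1)"
      by simp
    then show False
      by (simp add: var_t_def const_poly_def lookup_minus lookup_single)
  qed
  ultimately show False
    using assms complex_poly_commute [of "var_t - const_poly h" Q] unfolding primitive_def
    by (metis rangeE)
qed

subsection \<open>Conjugate polynomials\<close>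

text \<open>Conjugation extended to polynomials with \<open>s\<close> and \<open>t\<close> fixed;
  this anti-automorphism exchanges left and right factors.\<close>

definition pconj :: "qpoly \<Rightarrow> qpoly" where
  "pconj = Poly_Mapping.map qconj"

lemma lookup_pconj [simp]: "Poly_Mapping.lookup (pconj Q) k = qconj (Poly_Mapping.lookup Q k)"
  by (simp add: pconj_def Poly_Mapping.map.rep_eq when_def)

lemma pconj_single [simp]: "pconj (Poly_Mapping.single k x) = Poly_Mapping.single k (qconj x)"
  by (rule poly_mapping_eqI) (simp add: lookup_single when_def)

lemma pconj_0 [simp]: "pconj 0 = 0"
  and pconj_add [simp]: "pconj (P + Q) = pconj P + pconj Q"
  and pconj_diff [simp]: "pconj (P - Q) = pconj P - pconj Q"
  and pconj_pconj [simp]: "pconj (pconj P) = P"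
  by (rule poly_mapping_eqI; simp add: lookup_add lookup_minus)+

lemma pconj_mult [simp]: "pconj (P * Q) = pconj Q * pconj P"
proof (induction P rule: poly_mapping_single_induct)
  case (single k)
  show ?case
    by (induction Q rule: poly_mapping_single_induct)
      (simp_all add: mult_single add.commute distrib_left distrib_right)
qed (simp_all add: distrib_left distrib_right)

lemma pconj_linear [simp]: "pconj (var_t - const_poly h) = var_t - const_poly (qconj h)"
  by (simp add: var_t_def const_poly_def)

lemma pconj_real_quats: "Q \<in> polys_over real_quats \<Longrightarrow> pconj Q \<in> polys_over real_quats"
  by (simp add: polys_over_def real_quats_closed)

lemma pconj_complex_poly:
  assumes "P \<in> polys_over complex_quats"
  shows "pconj P = P"
proof (rule poly_mapping_eqI)
  fix k
  obtain c where "Poly_Mapping.lookup P k = of_complex c"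
    using assms unfolding polys_over_def complex_quats_def by blast
  then show "Poly_Mapping.lookup (pconj P) k = Poly_Mapping.lookup P k"
    by simp
qed

lemma eval_pconj [simp]: "eval_qpoly (pconj Q) s t = qconj (eval_qpoly Q s t)"
proof (induction Q rule: poly_mapping_single_induct)
  case (single k)
  show ?case
    by (cases k) (simp add: of_complex_commute)
qed simp_all

text \<open>A complex factor \<open>P\<close> is fixed by \<open>pconj\<close> and commutes with
  everything, so it divides \<open>pconj Q\<close> only if it divides \<open>Q\<close>.\<close>

lemma primitive_pconj:
  assumes "primitive Q"
  shows "primitive (pconj Q)"
  unfolding primitive_def
proof clarify
  fix P Q'
  assume P: "P \<in> polys_over complex_quats" "P \<notin> range const_poly" and "pconj Q = P * Q'"
  then have "Q = pconj Q' * pconj P"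
    by (metis pconj_mult pconj_pconj)
  then have "Q = P * pconj Q'"
    using P(1) by (metis pconj_complex_poly complex_poly_commute)
  then show False
    using assms P unfolding primitive_def by blast
qed

section \<open>Projective closures of null sets\<close>

lemma eval_coord_poly_superset:
  assumes "finite K" "Poly_Mapping.keys f \<subseteq> K"
  shows "eval_coord_poly f h = (\<Sum>(a, b, c, d)\<in>K. Poly_Mapping.lookup f (a, b, c, d)
    * coord1 h ^ a * coordi h ^ b * coordj h ^ c * coordk h ^ d)"
  unfolding eval_coord_poly_def
  by (rule sum.mono_neutral_left) (use assms in \<open>auto simp: in_keys_iff\<close>)

lemma eval_coord_poly_add [simp]:
  "eval_coord_poly (f + g) h = eval_coord_poly f h + eval_coord_poly g h"
proof -
  let ?K = "Poly_Mapping.keys f \<union> Poly_Mapping.keys g"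
  have "Poly_Mapping.keys (f + g) \<subseteq> ?K"
    by (rule keys_add)
  then show ?thesis
    by (simp add: eval_coord_poly_superset [where K = ?K] lookup_add distrib_right sum.distrib
        case_prod_unfold)
qed

lemma eval_coord_poly_single [simp]:
  "eval_coord_poly (Poly_Mapping.single (a, b, c, d) x) h
    = x * coord1 h ^ a * coordi h ^ b * coordj h ^ c * coordk h ^ d"
  by (cases "x = 0") (simp_all add: eval_coord_poly_def)

text \<open>Degree 1 yields all linear forms, and degree 2 with unit coefficients yields
  \<open>qnorm\<close>.\<close>

definition diag_form :: "nat \<Rightarrow> complex \<Rightarrow> complex \<Rightarrow> complex \<Rightarrow> complex \<Rightarrow> coord_poly" where
  "diag_form n x1 x2 x3 x4 =
     Poly_Mapping.single (n, 0, 0, 0) x1 + Poly_Mapping.single (0, n, 0, 0) x2 +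
     Poly_Mapping.single (0, 0, n, 0) x3 + Poly_Mapping.single (0, 0, 0, n) x4"

lemma homogeneous_diag_form: "homogeneous (diag_form n x1 x2 x3 x4)"
proof -
  have "Poly_Mapping.keys (diag_form n x1 x2 x3 x4)
      \<subseteq> {(n, 0, 0, 0), (0, n, 0, 0), (0, 0, n, 0), (0, 0, 0, n)}"
    unfolding diag_form_def by (intro order.trans [OF keys_add] Un_least) simp_all
  then show ?thesis
    unfolding homogeneous_def by (intro exI [of _ n]) auto
qed

lemma eval_diag_form [simp]:
  "eval_coord_poly (diag_form n x1 x2 x3 x4) h
    = x1 * coord1 h ^ n + x2 * coordi h ^ n + x3 * coordj h ^ n + x4 * coordk h ^ n"
  by (simp add: diag_form_def)

text \<open>The affine cone over a projective variety. Stability under scaling makes membership of a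
  point independent of the vector representing it.\<close>

definition homogeneous_locus :: "cquat set \<Rightarrow> bool" where
  "homogeneous_locus S \<longleftrightarrow>
     (\<exists>F. (\<forall>f\<in>F. homogeneous f) \<and> S = {h. \<forall>f\<in>F. eval_coord_poly f h = 0}) \<and>
     0 \<in> S \<and> (\<forall>c. \<forall>h\<in>S. of_complex c * h \<in> S)"

lemma homogeneous_locusI:
  assumes "\<And>f. f \<in> F \<Longrightarrow> homogeneous f" "S = {h. \<forall>f\<in>F. eval_coord_poly f h = 0}"
    and "0 \<in> S" "\<And>c h. h \<in> S \<Longrightarrow> of_complex c * h \<in> S"
  shows "homogeneous_locus S"
  unfolding homogeneous_locus_def by (intro conjI exI [of _ F] ballI allI assms)

text \<open>The projectivization of \<open>S\<close> is already closed, so the hull adds no points;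
  two vectors with the same point are multiples of each other.\<close>

lemma proj_point_in_proj_closure_iff:
  assumes "homogeneous_locus S" "h \<noteq> 0"
  shows "proj_point h \<in> proj_closure S \<longleftrightarrow> h \<in> S"
proof -
  have "zariski_closed {proj_point h | h. h \<in> S \<and> h \<noteq> 0}"
    using assms(1) unfolding homogeneous_locus_def zariski_closed_def by blast
  then have "proj_closure S = {proj_point h | h. h \<in> S \<and> h \<noteq> 0}"
    unfolding proj_closure_def by (rule hull_same)
  moreover have "h \<in> S" if "proj_point h = proj_point h'" "h' \<in> S" for h'
  proof -
    have "h \<in> proj_point h"
      unfolding proj_point_def by (auto intro: exI [of _ "1 :: complex"])
    then have "h \<in> proj_point h'"
      using that(1) by simp
    then obtain c where "h = of_complex c * h'"
      unfolding proj_point_def by blast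
    then show ?thesis
      using that(2) assms(1) unfolding homogeneous_locus_def by blast
  qed
  ultimately show ?thesis
    using assms(2) by auto
qed

text \<open>This removes the Zariski closure of an arbitrary \<open>T\<close>, such as the values of
  \<open>Q\<close> on a slice: monotonicity of the hull gives one direction, testing single points
  the other.\<close>

lemma proj_closure_subset_iff:
  assumes "homogeneous_locus S"
  shows "proj_closure T \<subseteq> proj_closure S \<longleftrightarrow> T \<subseteq> S"
proof
  assume *: "proj_closure T \<subseteq> proj_closure S"
  show "T \<subseteq> S"
  proof
    fix h assume "h \<in> T"
    show "h \<in> S"
    proof (cases "h = 0")
      case False
      then have "proj_point h \<in> proj_closure T"
        using \<open>h \<in> T\<close> unfolding proj_closure_def by (blast intro: hull_inc)
      then show ?thesis
        using * assms False proj_point_in_proj_closure_iff by blast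
    qed (use assms in \<open>simp add: homogeneous_locus_def\<close>)
  qed
next
  assume "T \<subseteq> S"
  then show "proj_closure T \<subseteq> proj_closure S"
    unfolding proj_closure_def by (intro hull_mono) blast
qed

section \<open>Equations of the null quadric and of the linear spaces\<close>

lemma proj_point_in_null_quadric_iff:
  assumes "h \<noteq> 0"
  shows "proj_point h \<in> null_quadric \<longleftrightarrow> h * qconj h = 0"
proof -
  have "homogeneous_locus {h. qnorm h = 0}"
  proof (rule homogeneous_locusI [of "{diag_form 2 1 1 1 1}"])
    have "qnorm (of_complex c * h) = c\<^sup>2 * qnorm h" for c h
      by (simp add: qnorm_def algebra_simps)
    then show "of_complex c * h \<in> {h. qnorm h = 0}" if "h \<in> {h. qnorm h = 0}" for c h
      using that by simp
  qed (simp_all add: homogeneous_diag_form qnorm_def)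
  then show ?thesis
    using assms by (simp add: null_quadric_def mult_qconj_eq_0_iff proj_point_in_proj_closure_iff)
qed

lemma homogeneous_locus_left: "homogeneous_locus {h. h * \<alpha> = 0}"
proof -
  obtain a b c d where \<alpha>: "\<alpha> = CQuat a b c d"
    by (cases \<alpha>)
  \<comment> \<open>The four coordinates of \<open>h * \<alpha>\<close> as linear forms in those of
    \<open>h\<close>.\<close>
  let ?F = "{diag_form 1 a (- b) (- c) (- d), diag_form 1 b a d (- c),
    diag_form 1 c (- d) a b, diag_form 1 d c (- b) a}"
  show ?thesis
  proof (rule homogeneous_locusI [of ?F])
    show "{h. h * \<alpha> = 0} = {h. \<forall>f\<in>?F. eval_coord_poly f h = 0}"
      by (simp add: \<alpha> cquat_eq_iff algebra_simps)
  qed (auto simp: homogeneous_diag_form mult.assoc)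
qed

lemma homogeneous_locus_right: "homogeneous_locus {h. \<alpha> * h = 0}"
proof -
  obtain a b c d where \<alpha>: "\<alpha> = CQuat a b c d"
    by (cases \<alpha>)
  \<comment> \<open>The same for \<open>\<alpha> * h\<close>; the signs of the cross terms
    change.\<close>
  let ?F = "{diag_form 1 a (- b) (- c) (- d), diag_form 1 b a (- d) c,
    diag_form 1 c d a (- b), diag_form 1 d (- c) b a}"
  show ?thesis
  proof (rule homogeneous_locusI [of ?F])
    show "{h. \<alpha> * h = 0} = {h. \<forall>f\<in>?F. eval_coord_poly f h = 0}"
      by (simp add: \<alpha> cquat_eq_iff algebra_simps)
  qed (auto simp: homogeneous_diag_form of_complex_left_commute)
qed

lemma slice_variety_subset_left_space_iff:
  "slice_variety Q p \<subseteq> left_space \<alpha> \<longleftrightarrow> (\<forall>s. eval_qpoly Q s p * \<alpha> = 0)"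
  unfolding slice_variety_def left_space_def proj_closure_subset_iff [OF homogeneous_locus_left]
  by auto

lemma slice_variety_subset_right_space_iff:
  "slice_variety Q p \<subseteq> right_space \<alpha> \<longleftrightarrow> (\<forall>s. \<alpha> * eval_qpoly Q s p = 0)"
  unfolding slice_variety_def right_space_def proj_closure_subset_iff [OF homogeneous_locus_right]
  by auto

section \<open>Linear factors\<close>

lemma right_factor_iff:
  assumes "Q \<in> polys_over real_quats" "primitive Q"
  shows "(\<exists>\<alpha>. \<alpha> \<noteq> 0 \<and> qconj \<alpha> * \<alpha> = 0 \<and> (\<forall>s. eval_qpoly Q s p * \<alpha> = 0) \<and>
        (\<forall>s. eval_qpoly Q s (cnj p) * cconj \<alpha> = 0)) \<longleftrightarrow>
      (\<exists>Q'\<in>polys_over real_quats. \<exists>h\<in>real_quats. Q = Q' * (var_t - const_poly h) \<and>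
        (of_complex p - h) * qconj (of_complex p - h) = 0)"
    (is "?L \<longleftrightarrow> ?R")
proof
  assume ?L
  then obtain \<alpha> where \<alpha>: "\<alpha> \<noteq> 0" "\<alpha> * qconj \<alpha> = 0" "\<And>s. eval_qpoly Q s p * \<alpha> = 0"
    by (auto simp: mult_qconj_eq_0_commute)
  obtain h where h: "h \<in> real_quats" "(of_complex p - h) * \<alpha> = 0"
    using real_quat_root \<alpha>(1,2) by blast
  obtain Q' R where Q': "Q' \<in> polys_over real_quats" "R \<in> polys_over real_quats"
    "Poly_Mapping.keys R \<subseteq> UNIV \<times> {0}" "Q = Q' * (var_t - const_poly h) + R"
    using linear_division [OF h(1) assms(1)] by blast
  \<comment> \<open>At \<open>t = p\<close> the factor \<open>p - h\<close> annihilates \<alpha>, so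
    only the remainder survives.\<close>
  have "eval_qpoly R s p * \<alpha> = 0" for s
    using \<alpha>(3) [of s] by (simp add: Q'(4) distrib_right mult.assoc h(2))
  then have "R = 0"
    using t_free_annihilated_eq_0 [OF Q'(2,3) \<alpha>(1)] by blast
  then show ?R
    using Q'(1,4) h(1) null_if_annihilates [OF h(2) \<alpha>(1)] by auto
next
  assume ?R
  then obtain Q' h where *: "h \<in> real_quats" "Q = Q' * (var_t - const_poly h)"
    "(of_complex p - h) * qconj (of_complex p - h) = 0"
    by blast
  let ?\<alpha> = "qconj (of_complex p - h)"
  have "?\<alpha> \<noteq> 0"
    using primitive_linear_factor [of Q' h p] assms(2) by (simp add: *(2) del: qconj_simps)
  moreover have "qconj ?\<alpha> * ?\<alpha> = 0"
    using *(3) by simp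
  moreover have "eval_qpoly Q s p * ?\<alpha> = 0" for s
    using *(3) by (simp add: *(2) mult.assoc del: qconj_simps)
  moreover have "eval_qpoly Q s (cnj p) * cconj ?\<alpha> = 0" for s
  proof -
    \<comment> \<open>As \<open>h\<close> is real, complex conjugation turns \<open>p - h\<close>
      into \<open>cnj p - h\<close>.\<close>
    have "(of_complex (cnj p) - h) * cconj ?\<alpha> = 0"
      using arg_cong [where f = cconj, OF *(3)] *(1) by (simp add: cconj_real_quat)
    then show ?thesis
      by (simp add: *(2) mult.assoc del: qconj_simps cconj_simps)
  qed
  ultimately show ?L
    by blast
qed

lemma left_factor_iff:
  assumes "Q \<in> polys_over real_quats" "primitive Q"
  shows "(\<exists>\<alpha>. \<alpha> \<noteq> 0 \<and> qconj \<alpha> * \<alpha> = 0 \<and> (\<forall>s. \<alpha> * eval_qpoly Q s p = 0) \<and>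
        (\<forall>s. cconj \<alpha> * eval_qpoly Q s (cnj p) = 0)) \<longleftrightarrow>
      (\<exists>Q'\<in>polys_over real_quats. \<exists>h\<in>real_quats. Q = (var_t - const_poly h) * Q' \<and>
        (of_complex p - h) * qconj (of_complex p - h) = 0)"
    (is "(\<exists>\<alpha>. ?L \<alpha>) \<longleftrightarrow> (\<exists>Q'\<in>_. \<exists>h\<in>_. ?R Q' h)")
proof -
  let ?L' = "\<lambda>\<alpha>. \<alpha> \<noteq> 0 \<and> qconj \<alpha> * \<alpha> = 0 \<and> (\<forall>s. eval_qpoly (pconj Q) s p * \<alpha> = 0) \<and>
        (\<forall>s. eval_qpoly (pconj Q) s (cnj p) * cconj \<alpha> = 0)"
  let ?R' = "\<lambda>Q' h. pconj Q = Q' * (var_t - const_poly h) \<and>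
        (of_complex p - h) * qconj (of_complex p - h) = 0"
  have "x * y = 0 \<longleftrightarrow> qconj y * qconj x = 0" for x y
    by (metis qconj_eq_0_iff qconj_simps(5))
  then have "?L \<alpha> \<longleftrightarrow> ?L' (qconj \<alpha>)" for \<alpha>
    by (simp add: mult_qconj_eq_0_commute)
  then have "(\<exists>\<alpha>. ?L \<alpha>) \<longleftrightarrow> (\<exists>\<alpha>. ?L' \<alpha>)"
    by (metis qconj_simps(6))
  also have "\<dots> \<longleftrightarrow> (\<exists>Q'\<in>polys_over real_quats. \<exists>h\<in>real_quats. ?R' Q' h)"
    using assms by (intro right_factor_iff pconj_real_quats primitive_pconj)
  also have "\<dots> \<longleftrightarrow> (\<exists>Q'\<in>polys_over real_quats. \<exists>h\<in>real_quats. ?R Q' h)"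
  proof -
    have "pconj Q = Q' * (var_t - const_poly h) \<longleftrightarrow>
        Q = (var_t - const_poly (qconj h)) * pconj Q'" for Q' h
      by (metis pconj_linear pconj_mult pconj_pconj)
    moreover have "x * qconj x = 0 \<longleftrightarrow> qconj x * qconj (qconj x) = 0" for x
      by (simp add: mult_qconj_eq_0_commute)
    \<comment> \<open>Since \<open>p\<close> is fixed by \<open>qconj\<close>, passing from
      \<open>h\<close> to \<open>qconj h\<close> conjugates \<open>p - h\<close>, which preserves
      nullity.\<close>
    then have "(of_complex p - h) * qconj (of_complex p - h) = 0 \<longleftrightarrow>
        (of_complex p - qconj h) * qconj (of_complex p - qconj h) = 0" for h
      by (metis qconj_simps(4,7))
    ultimately have "?R' Q' h \<longleftrightarrow> ?R (pconj Q') (qconj h)" for Q' h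
      by simp
    \<comment> \<open>\<open>pconj\<close> and \<open>qconj\<close> are involutions preserving real
      coefficients, so the witnesses on the two sides correspond.\<close>
    then show ?thesis
      by (metis pconj_pconj pconj_real_quats qconj_simps(6) real_quats_closed(4))
  qed
  finally show ?thesis .
qed

theorem corollary1:
  fixes Q :: qpoly and p :: complex
  assumes "Q \<in> polys_over real_quats" and "primitive Q"
  shows
    "((\<exists>\<alpha>. \<alpha> \<noteq> 0 \<and> proj_point (qconj \<alpha>) \<in> null_quadric \<and>
          slice_variety Q p \<subseteq> left_space \<alpha> \<and>
          slice_variety Q (cnj p) \<subseteq> left_space (cconj \<alpha>)) \<longleftrightarrow>
      (\<exists>Q' \<in> polys_over real_quats. \<exists>h \<in> real_quats.
          Q = Q' * (var_t - const_poly h) \<and>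
          (of_complex p - h) * qconj (of_complex p - h) = 0)) \<and>
     ((\<exists>\<alpha>. \<alpha> \<noteq> 0 \<and> proj_point (qconj \<alpha>) \<in> null_quadric \<and>
          slice_variety Q p \<subseteq> right_space \<alpha> \<and>
          slice_variety Q (cnj p) \<subseteq> right_space (cconj \<alpha>)) \<longleftrightarrow>
      (\<exists>Q' \<in> polys_over real_quats. \<exists>h \<in> real_quats.
          Q = (var_t - const_poly h) * Q' \<and>
          (of_complex p - h) * qconj (of_complex p - h) = 0))"
proof -
  \<comment> \<open>The conjunct \<open>\<alpha> \<noteq> 0\<close> is kept in the equivalence
    because membership in the quadric is characterized for non-zero vectors.\<close>
  have "\<alpha> \<noteq> 0 \<and> proj_point (qconj \<alpha>) \<in> null_quadric \<and> A \<longleftrightarrow> \<alpha> \<noteq> 0 \<and> qconj \<alpha> * \<alpha> = 0 \<and> A" for \<alpha> A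
    using proj_point_in_null_quadric_iff [of "qconj \<alpha>"] by auto
  then show ?thesis
    unfolding slice_variety_subset_left_space_iff slice_variety_subset_right_space_iff
    using right_factor_iff [OF assms] left_factor_iff [OF assms] by simp
qed

end
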